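(* Let $A$ be a $*$-algebra over $K$ and let $\mu_1,\mu_2\in K\setminus\{0\}$. Suppose that $\gamma_1,\gamma_2$ are $A$-involutions of $\mathrm{Cay}(A,\mu_1)$ and $\mathrm{Cay}(A,\mu_2)$, respectively, of the form $$\gamma_i(x,y)=(x^*+a_i y^*,\ b_i y)\qquad (x,y\in A,\ i=1,2),$$ where, for $i=1,2$, the elements $a_i,b_i\in A$ satisfy: $a_i\in N(A)$ and $a_i$ is a skew $*$-element; $b_i\in N_l(A)$ and $b_i^2=1$; $a_i=b_ia_i$; and $\mu_i xy=a_i^2(xy)+\mu_i(xb_i^* )(b_iy)$ for all $x,y\in A$. Then $\mathrm{Cay}_{\gamma_1}(A,\mu_1)$ and $\mathrm{Cay}_{\gamma_2}(A,\mu_2)$ are $A$-isomorphic as $*$-algebras if and only if there exist $c,d\in A$ satisfying 1. $c\in N(A)$ and $c$ is a skew $*$-element, 2. $d\in N_l(A)$ and the map $A\to A$, $x\mapsto dx$, is bijective, 3. $\mu_1 xy=c^2(xy)+\mu_2(xd^* )(dy)$ for all $x,y\in A$, such that $$a_1=(1+b_2)c^*+a_2d^*\quad\text{and}\quad b_1=d^{-1}b_2d,$$ where $d^{-1}\in N_l(A)$ is the unique left and the unique right inverse of $d$. In this case, a $*$-algebra $A$-isomorphism $\phi\colon \mathrm{Cay}_{\gamma_1}(A,\mu_1)\to \mathrm{Cay}_{\gamma_2}(A,\mu_2)$ is given by $$\phi(x,y)=(x+cy^*,\,dy)\qquad (x,y\in A).$$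
   Context: All rings and algebras are unital. $K$ is a commutative associative ring; an algebra $A$ over $K$ is not assumed commutative or associative. An involution of $A$ is a $K$-linear map $x\mapsto x^*$ with $(x^* )^*=x$ and $(xy)^*=y^*x^*$ for all $x,y\in A$; a $*$-algebra is an algebra equipped with an involution. For a $*$-algebra $A$ and $\mu\in K\setminus\{0\}$, the Cayley double $\mathrm{Cay}(A,\mu)$ is the $K$-algebra with underlying module $A\oplus A$ and multiplication $(u,v)(x,y)=(ux+\mu y^*v,\ vx^*+yu)$. An $A$-involution of $\mathrm{Cay}(A,\mu)$ is an involution $\gamma$ of $\mathrm{Cay}(A,\mu)$ such that $\gamma(x,0)=(x^*,0)$ for all $x\in A$. $\mathrm{Cay}_\gamma(A,\mu)$ denotes the $*$-algebra obtained by equipping $\mathrm{Cay}(A,\mu)$ with the $A$-involution $\gamma$. An $A$-isomorphism $\phi\colon\mathrm{Cay}(A,\mu_1)\to \mathrm{Cay}(A,\mu_2)$ is a $K$-algebra isomorphism with $\phi(x,0)=(x,0)$ for all $x\in A$. A $*$-algebra $A$-isomorphism $\mathrm{Cay}_{\gamma_1}(A,\mu_1)\to \mathrm{Cay}_{\gamma_2}(A,\mu_2)$ is an $A$-isomorphism $\phi$ with $\phi\circ\gamma_1=\gamma_2\circ\phi$; the two are $A$-isomorphic as $*$-algebras if such a $\phi$ exists. The associator is $(x,y,z)=(xy)z-x(yz)$. The left nucleus is $N_l(A)=\{x\in A\mid (x,y,z)=0\ \forall y,z\in A\}$, the middle nucleus is $N_m(A)=\{y\in A\mid (x,y,z)=0\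 \forall x,z\in A\}$, the right nucleus is $N_r(A)=\{z\in A\mid (x,y,z)=0\ \forall x,y\in A\}$, and the nucleus is $N(A)=N_l(A)\cap N_m(A)\cap N_r(A)$. An element $a\in A$ is skew if $a^*=-a$; it is a $*$-element if $ax=x^*a$ for all $x\in A$; a skew $*$-element is an element that is both.
   Formalization: The inverse of d is shown to be the unique right inverse in A, but the unique left inverse only among elements of N_l(A); uniqueness among all left inverses in A fails in general, even under all the hypotheses. *)

theory Defs
  imports Complex_Main "HOL-Library.Product_Plus"
begin

(* The class comm_ring_1 excludes the zero ring. Nothing is lost: a nonzero scalar is always
   given below. The algebra itself may be zero, and is neither commutative nor associative. *)

locale nonassoc_algebra = module scale
  for scale :: "'k::comm_ring_1 \<Rightarrow> 'a::ab_group_add \<Rightarrow> 'a" (infixr \<open>*s\<close> 75) +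
  fixes mult :: "'a \<Rightarrow> 'a \<Rightarrow> 'a" (infixl \<open>\<odot>\<close> 70)
    and one :: 'a
  assumes mult_add_left: "(x + y) \<odot> z = x \<odot> z + y \<odot> z"
    and mult_add_right: "x \<odot> (y + z) = x \<odot> y + x \<odot> z"
    and mult_scale_left: "(k *s x) \<odot> y = k *s (x \<odot> y)"
    and mult_scale_right: "x \<odot> (k *s y) = k *s (x \<odot> y)"
    and mult_one_left: "one \<odot> x = x"
    and mult_one_right: "x \<odot> one = x"

definition involution ::
    "('k::comm_ring_1 \<Rightarrow> 'a::ab_group_add \<Rightarrow> 'a) \<Rightarrow> ('a \<Rightarrow> 'a \<Rightarrow> 'a) \<Rightarrow> ('a \<Rightarrow> 'a) \<Rightarrow> bool" where
  "involution scale mult star \<longleftrightarrow>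
     module_hom scale scale star \<and>
     (\<forall>x. star (star x) = x) \<and>
     (\<forall>x y. star (mult x y) = mult (star y) (star x))"

locale star_algebra = nonassoc_algebra scale mult one
  for scale :: "'k::comm_ring_1 \<Rightarrow> 'a::ab_group_add \<Rightarrow> 'a" (infixr \<open>*s\<close> 75)
    and mult :: "'a \<Rightarrow> 'a \<Rightarrow> 'a" (infixl \<open>\<odot>\<close> 70)
    and one :: 'a +
  fixes star :: "'a \<Rightarrow> 'a"
  assumes involution_star: "involution scale mult star"

definition algebra_iso ::
    "('k::comm_ring_1 \<Rightarrow> 'a::ab_group_add \<Rightarrow> 'a) \<Rightarrow> ('a \<Rightarrow> 'a \<Rightarrow> 'a) \<Rightarrow> 'a \<Rightarrow>
     ('k \<Rightarrow> 'b::ab_group_add \<Rightarrow> 'b) \<Rightarrow> ('b \<Rightarrow> 'b \<Rightarrow> 'b) \<Rightarrow> 'b \<Rightarrow> ('a \<Rightarrow> 'b) \<Rightarrow> bool" where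
  "algebra_iso scale1 mult1 one1 scale2 mult2 one2 \<phi> \<longleftrightarrow>
     module_hom scale1 scale2 \<phi> \<and> bij \<phi> \<and>
     (\<forall>x y. \<phi> (mult1 x y) = mult2 (\<phi> x) (\<phi> y)) \<and> \<phi> one1 = one2"

definition associator :: "('a \<Rightarrow> 'a \<Rightarrow> 'a::ab_group_add) \<Rightarrow> 'a \<Rightarrow> 'a \<Rightarrow> 'a \<Rightarrow> 'a" where
  "associator mult x y z = mult (mult x y) z - mult x (mult y z)"

definition left_nucleus :: "('a \<Rightarrow> 'a \<Rightarrow> 'a::ab_group_add) \<Rightarrow> 'a set" where
  "left_nucleus mult = {x. \<forall>y z. associator mult x y z = 0}"

definition middle_nucleus :: "('a \<Rightarrow> 'a \<Rightarrow> 'a::ab_group_add) \<Rightarrow> 'a set" where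
  "middle_nucleus mult = {y. \<forall>x z. associator mult x y z = 0}"

definition right_nucleus :: "('a \<Rightarrow> 'a \<Rightarrow> 'a::ab_group_add) \<Rightarrow> 'a set" where
  "right_nucleus mult = {z. \<forall>x y. associator mult x y z = 0}"

definition nucleus :: "('a \<Rightarrow> 'a \<Rightarrow> 'a::ab_group_add) \<Rightarrow> 'a set" where
  "nucleus mult = left_nucleus mult \<inter> middle_nucleus mult \<inter> right_nucleus mult"

definition skew :: "('a \<Rightarrow> 'a::ab_group_add) \<Rightarrow> 'a \<Rightarrow> bool" where
  "skew star a \<longleftrightarrow> star a = - a"

definition star_element :: "('a \<Rightarrow> 'a \<Rightarrow> 'a) \<Rightarrow> ('a \<Rightarrow> 'a) \<Rightarrow> 'a \<Rightarrow> bool" where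
  "star_element mult star a \<longleftrightarrow> (\<forall>x. mult a x = mult (star x) a)"

(* Inverses are taken inside the left nucleus: that is where the left inverse is unique
   (in the whole algebra there may be further left inverses). *)
definition nuc_inverse :: "('a \<Rightarrow> 'a \<Rightarrow> 'a::ab_group_add) \<Rightarrow> 'a \<Rightarrow> 'a \<Rightarrow> 'a" where
  "nuc_inverse mult one d =
     (THE e. e \<in> left_nucleus mult \<and> mult e d = one \<and> mult d e = one)"

fun cay_scale :: "('k \<Rightarrow> 'a \<Rightarrow> 'a) \<Rightarrow> 'k \<Rightarrow> 'a \<times> 'a \<Rightarrow> 'a \<times> 'a" where
  "cay_scale scale k (x, y) = (scale k x, scale k y)"

fun cay_mult ::
    "('k \<Rightarrow> 'a::ab_group_add \<Rightarrow> 'a) \<Rightarrow> ('a \<Rightarrow> 'a \<Rightarrow> 'a) \<Rightarrow> ('a \<Rightarrow> 'a) \<Rightarrow> 'k \<Rightarrow>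
     'a \<times> 'a \<Rightarrow> 'a \<times> 'a \<Rightarrow> 'a \<times> 'a" where
  "cay_mult scale mult star \<mu> (u, v) (x, y) =
     (mult u x + scale \<mu> (mult (star y) v), mult v (star x) + mult y u)"

definition cay_one :: "'a \<Rightarrow> 'a::ab_group_add \<times> 'a" where
  "cay_one one = (one, 0)"

lemma (in star_algebra) nonassoc_algebra_cay:
  "nonassoc_algebra (cay_scale scale) (cay_mult scale mult star \<mu>) (cay_one one)"
proof -
  interpret star: module_hom scale scale star
    using involution_star by (simp add: involution_def)
  have star_star: "star (star x) = x" and star_mult: "star (x \<odot> y) = star y \<odot> star x" for x y
    using involution_star by (auto simp: involution_def)
  have star_one: "star one = one"
    by (metis star_star star_mult mult_one_left mult_one_right)
  have mult_zero: "0 \<odot> x = 0" "x \<odot> 0 = 0" for x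
    using mult_add_left[of 0 0 x] mult_add_right[of x 0 0] by simp_all
  show ?thesis
    by unfold_locales
      (auto simp: cay_one_def scale_right_distrib scale_left_distrib mult_add_left mult_add_right
        mult_scale_left mult_scale_right mult_one_left mult_one_right star.add star.scale
        star_one mult_zero star.zero scale_left_commute[of \<mu>] mult.commute)
qed

definition A_involution ::
    "('k::comm_ring_1 \<Rightarrow> 'a::ab_group_add \<Rightarrow> 'a) \<Rightarrow> ('a \<Rightarrow> 'a \<Rightarrow> 'a) \<Rightarrow> ('a \<Rightarrow> 'a) \<Rightarrow> 'k \<Rightarrow>
     ('a \<times> 'a \<Rightarrow> 'a \<times> 'a) \<Rightarrow> bool" where
  "A_involution scale mult star \<mu> \<gamma> \<longleftrightarrow>
     involution (cay_scale scale) (cay_mult scale mult star \<mu>) \<gamma> \<and>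
     (\<forall>x. \<gamma> (x, 0) = (star x, 0))"

definition A_isomorphism ::
    "('k::comm_ring_1 \<Rightarrow> 'a::ab_group_add \<Rightarrow> 'a) \<Rightarrow> ('a \<Rightarrow> 'a \<Rightarrow> 'a) \<Rightarrow> 'a \<Rightarrow> ('a \<Rightarrow> 'a) \<Rightarrow>
     'k \<Rightarrow> 'k \<Rightarrow> ('a \<times> 'a \<Rightarrow> 'a \<times> 'a) \<Rightarrow> bool" where
  "A_isomorphism scale mult one star \<mu>1 \<mu>2 \<phi> \<longleftrightarrow>
     algebra_iso (cay_scale scale) (cay_mult scale mult star \<mu>1) (cay_one one)
                 (cay_scale scale) (cay_mult scale mult star \<mu>2) (cay_one one) \<phi> \<and>
     (\<forall>x. \<phi> (x, 0) = (x, 0))"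

definition star_A_isomorphism ::
    "('k::comm_ring_1 \<Rightarrow> 'a::ab_group_add \<Rightarrow> 'a) \<Rightarrow> ('a \<Rightarrow> 'a \<Rightarrow> 'a) \<Rightarrow> 'a \<Rightarrow> ('a \<Rightarrow> 'a) \<Rightarrow>
     'k \<Rightarrow> ('a \<times> 'a \<Rightarrow> 'a \<times> 'a) \<Rightarrow> 'k \<Rightarrow> ('a \<times> 'a \<Rightarrow> 'a \<times> 'a) \<Rightarrow>
     ('a \<times> 'a \<Rightarrow> 'a \<times> 'a) \<Rightarrow> bool" where
  "star_A_isomorphism scale mult one star \<mu>1 \<gamma>1 \<mu>2 \<gamma>2 \<phi> \<longleftrightarrow>
     A_isomorphism scale mult one star \<mu>1 \<mu>2 \<phi> \<and> \<phi> \<circ> \<gamma>1 = \<gamma>2 \<circ> \<phi>"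

definition star_A_isomorphic ::
    "('k::comm_ring_1 \<Rightarrow> 'a::ab_group_add \<Rightarrow> 'a) \<Rightarrow> ('a \<Rightarrow> 'a \<Rightarrow> 'a) \<Rightarrow> 'a \<Rightarrow> ('a \<Rightarrow> 'a) \<Rightarrow>
     'k \<Rightarrow> ('a \<times> 'a \<Rightarrow> 'a \<times> 'a) \<Rightarrow> 'k \<Rightarrow> ('a \<times> 'a \<Rightarrow> 'a \<times> 'a) \<Rightarrow> bool" where
  "star_A_isomorphic scale mult one star \<mu>1 \<gamma>1 \<mu>2 \<gamma>2 \<longleftrightarrow>
     (\<exists>\<phi>. star_A_isomorphism scale mult one star \<mu>1 \<gamma>1 \<mu>2 \<gamma>2 \<phi>)"

end

theory Submission
  imports Defs
begin

text \<open>
  An \<open>A\<close>-isomorphism of Cayley doubles is determined by the image \<open>(c, d)\<close> of \<open>(0, 1)\<close>: since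
  \<open>(0, y) = (y, 0)(0, 1)\<close>, it has to be \<open>\<phi>(x, y) = (x + yc, dy)\<close>. Multiplicativity on products
  of elements \<open>(x, 0)\<close> and \<open>(0, y)\<close> then forces all conditions on \<open>c\<close> and \<open>d\<close>. The mixed products
  put \<open>d\<close> in the left nucleus and make \<open>c\<close> a \<open>*\<close>-element, so that \<open>yc = cy\<^sup>*\<close>. The products
  of two elements \<open>(0, y)\<close> make \<open>c\<close> skew, give the equation that compares \<open>\<mu>\<^sub>1\<close> with \<open>\<mu>\<^sub>2\<close>, and
  together with the mixed ones place \<open>c\<close> in the nucleus (\<open>A_isomorphism_imp_data\<close>). Conversely,
  these conditions suffice (\<open>A_isomorphism_if_data\<close>).

  It remains to see what it means that \<open>\<phi>\<close> intertwines the two involutions. Evaluated at \<open>(0, 1)\<close>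
  this says \<open>d b\<^sub>1 = b\<^sub>2 d\<close> and \<open>a\<^sub>1 + b\<^sub>1 c = c\<^sup>* + a\<^sub>2 d\<^sup>*\<close>. What turns the second equation into the
  asserted one is that a nuclear \<open>*\<close>-element \<open>c\<close> annihilates all commutators, \<open>(xy)c = (yx)c\<close>
  (\<open>nuclear_star_element_commutator\<close>): a conjugate \<open>b\<^sub>1 = d\<inverse> b\<^sub>2 d\<close> and \<open>b\<^sub>2\<close> itself therefore have
  the same product with \<open>c\<close>, and \<open>b\<^sub>1 c\<close> may be replaced by \<open>b\<^sub>2 c = - b\<^sub>2 c\<^sup>*\<close>. By the same
  cancellation the identities at \<open>(0, 1)\<close> imply those at every \<open>(0, y)\<close>
  (\<open>intertwines_involutions_iff\<close>).
\<close>

section \<open>Algebras that need not be associative\<close>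

context nonassoc_algebra
begin

lemma mult_zero: "0 \<odot> x = 0" "x \<odot> 0 = 0"
  using mult_add_left[of 0 0 x] mult_add_right[of x 0 0] by simp_all

lemma mult_minus_left: "(- x) \<odot> y = - (x \<odot> y)"
  using mult_add_left[of "- x" x y] by (simp add: mult_zero eq_neg_iff_add_eq_0)

lemma mult_minus_right: "x \<odot> (- y) = - (x \<odot> y)"
  using mult_add_right[of x "- y" y] by (simp add: mult_zero eq_neg_iff_add_eq_0)

lemma in_left_nucleus_iff: "x \<in> left_nucleus mult \<longleftrightarrow> (\<forall>y z. (x \<odot> y) \<odot> z = x \<odot> (y \<odot> z))"
  by (simp add: left_nucleus_def associator_def)

lemma in_nucleus_iff:
  "c \<in> nucleus mult \<longleftrightarrow>
     (\<forall>x y. (c \<odot> x) \<odot> y = c \<odot> (x \<odot> y) \<and> (x \<odot> c) \<odot> y = x \<odot> (c \<odot> y) \<and> (x \<odot> y) \<odot> c = x \<odot> (y \<odot> c))"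
  by (auto simp: nucleus_def left_nucleus_def middle_nucleus_def right_nucleus_def associator_def)

text \<open>
  The preimage \<open>e\<close> of \<open>1\<close> under left multiplication by \<open>d\<close> lies in the left nucleus because
  \<open>d((ex)y) = (d(ex))y = xy = d(e(xy))\<close> and \<open>d\<close> can be cancelled on the left; it is a left
  inverse because \<open>d(ed) = (de)d = d\<close>.
\<close>

lemma nuc_inverse_exists:
  assumes d: "d \<in> left_nucleus mult" and bij: "bij (\<lambda>x. d \<odot> x)"
  shows "\<exists>e. e \<in> left_nucleus mult \<and> e \<odot> d = one \<and> d \<odot> e = one"
proof -
  have d_assoc: "(d \<odot> x) \<odot> y = d \<odot> (x \<odot> y)" for x y
    using d by (simp add: in_left_nucleus_iff)
  have cancel: "d \<odot> x = d \<odot> y \<Longrightarrow> x = y" for x y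
    using bij by (simp add: bij_def inj_def)
  obtain e where e: "d \<odot> e = one"
    using bij by (metis bij_pointE)
  have "d \<odot> (e \<odot> x) = x" for x
    by (simp flip: d_assoc add: e mult_one_left)
  then have "d \<odot> ((e \<odot> x) \<odot> y) = d \<odot> (e \<odot> (x \<odot> y))" for x y
    by (simp flip: d_assoc add: e mult_one_left)
  moreover have "d \<odot> (e \<odot> d) = d \<odot> one"
    by (simp flip: d_assoc add: e mult_one_left mult_one_right)
  ultimately show ?thesis
    using cancel e unfolding in_left_nucleus_iff by blast
qed

lemma left_nucleus_inverse_unique:
  assumes "e \<in> left_nucleus mult" "e \<odot> d = one" "d \<odot> f = one"
  shows "e = f"
  using assms by (metis in_left_nucleus_iff mult_one_left mult_one_right)

lemma nuc_inverse:
  assumes "d \<in> left_nucleus mult" "bij (\<lambda>x. d \<odot> x)"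
  shows "nuc_inverse mult one d \<in> left_nucleus mult"
    and "nuc_inverse mult one d \<odot> d = one"
    and "d \<odot> nuc_inverse mult one d = one"
proof -
  have "\<exists>!e. e \<in> left_nucleus mult \<and> e \<odot> d = one \<and> d \<odot> e = one"
    using nuc_inverse_exists[OF assms] left_nucleus_inverse_unique by metis
  from theI'[OF this] show "nuc_inverse mult one d \<in> left_nucleus mult"
    "nuc_inverse mult one d \<odot> d = one" "d \<odot> nuc_inverse mult one d = one"
    unfolding nuc_inverse_def by simp_all
qed

lemma right_inverse_iff:
  assumes "d \<in> left_nucleus mult" "bij (\<lambda>x. d \<odot> x)"
  shows "d \<odot> e = one \<longleftrightarrow> e = nuc_inverse mult one d"
  using nuc_inverse[OF assms] assms(2) by (metis bij_pointE)

lemma left_inverse_iff: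
  assumes "d \<in> left_nucleus mult" "bij (\<lambda>x. d \<odot> x)" "e \<in> left_nucleus mult"
  shows "e \<odot> d = one \<longleftrightarrow> e = nuc_inverse mult one d"
  using nuc_inverse[OF assms(1,2)] left_nucleus_inverse_unique assms(3) by metis

lemma conjugate_by_nuc_inverse_iff:
  assumes "d \<in> left_nucleus mult" "bij (\<lambda>x. d \<odot> x)"
  shows "b = (nuc_inverse mult one d \<odot> b') \<odot> d \<longleftrightarrow> d \<odot> b = b' \<odot> d"
  using nuc_inverse[OF assms] assms(1) by (metis in_left_nucleus_iff mult_one_left)

end

section \<open>Nuclear *-elements\<close>

context star_algebra
begin

lemma star_star: "star (star x) = x"
  and star_mult: "star (x \<odot> y) = star y \<odot> star x"
  and star_module_hom: "module_hom scale scale star"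
  using involution_star by (auto simp: involution_def)

lemma star_add: "star (x + y) = star x + star y"
  and star_scale: "star (k *s x) = k *s star x"
  and star_zero: "star 0 = 0"
  and star_minus: "star (- x) = - star x"
  using module_hom.add[OF star_module_hom] module_hom.scale[OF star_module_hom]
    module_hom.zero[OF star_module_hom] module_hom.neg[OF star_module_hom] by auto

lemma star_one: "star one = one"
  by (metis star_star star_mult mult_one_left mult_one_right)

text \<open>
  Move \<open>c\<close> through the product \<open>xy\<close>, once as a whole and once factor by factor: since \<open>*\<close>
  reverses products, \<open>c(xy) = (y\<^sup>* x\<^sup>*)c\<close>, but also \<open>c(xy) = (x\<^sup>* y\<^sup>*)c\<close>.
\<close>

lemma nuclear_star_element_commutator:
  assumes "c \<in> nucleus mult" "star_element mult star c"
  shows "(x \<odot> y) \<odot> c = (y \<odot> x) \<odot> c" and "c \<odot> (x \<odot> y) = c \<odot> (y \<odot> x)"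
proof -
  have move: "c \<odot> z = star z \<odot> c" for z
    using assms(2) by (simp add: star_element_def)
  have *: "(star y \<odot> star x) \<odot> c = (star x \<odot> star y) \<odot> c" for x y
  proof -
    have "(star y \<odot> star x) \<odot> c = c \<odot> (x \<odot> y)"
      by (simp add: move star_mult)
    also have "\<dots> = star x \<odot> (c \<odot> y)"
      using assms(1) unfolding in_nucleus_iff by (metis move)
    also have "\<dots> = (star x \<odot> star y) \<odot> c"
      using assms(1) unfolding in_nucleus_iff by (metis move)
    finally show ?thesis .
  qed
  show "(x \<odot> y) \<odot> c = (y \<odot> x) \<odot> c"
    using *[of "star y" "star x"] by (simp add: star_star)
  show "c \<odot> (x \<odot> y) = c \<odot> (y \<odot> x)"
    using *[of x y] by (simp add: move star_mult)
qed

text \<open>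
  This is the first coordinate that \<open>c\<close> contributes to the product of the images of \<open>(0, v)\<close> and
  \<open>(0, y)\<close>. Pulling both factors \<open>c\<close> to the left reverses the order of \<open>v\<close> and \<open>y\<^sup>*\<close> at no cost,
  because \<open>c\<close> annihilates commutators.
\<close>

lemma nuclear_star_element_mult_square:
  assumes c: "c \<in> nucleus mult" "star_element mult star c"
  shows "(v \<odot> c) \<odot> (y \<odot> c) = (c \<odot> c) \<odot> (star y \<odot> v)"
proof -
  have nuc: "(c \<odot> x) \<odot> z = c \<odot> (x \<odot> z)" "(x \<odot> c) \<odot> z = x \<odot> (c \<odot> z)" for x z
    using c(1) by (simp_all add: in_nucleus_iff)
  have move: "x \<odot> c = c \<odot> star x" for x
    using c(2) by (simp add: star_element_def star_star)
  have "(v \<odot> c) \<odot> (y \<odot> c) = c \<odot> (star v \<odot> (c \<odot> star y))"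
    by (simp add: move nuc)
  also have "star v \<odot> (c \<odot> star y) = c \<odot> (v \<odot> star y)"
    by (metis move nuc star_star)
  also have "\<dots> = c \<odot> (star y \<odot> v)"
    by (rule nuclear_star_element_commutator(2)[OF c])
  finally show ?thesis
    by (simp add: nuc)
qed

section \<open>Isomorphisms of Cayley doubles over the base algebra\<close>

text \<open>The conditions under which \<open>(c, d)\<close> is the image of \<open>(0, 1)\<close> under an \<open>A\<close>-isomorphism.\<close>

definition cay_iso_data :: "'k \<Rightarrow> 'k \<Rightarrow> 'a \<Rightarrow> 'a \<Rightarrow> bool" where
  "cay_iso_data \<mu>1 \<mu>2 c d \<longleftrightarrow>
     c \<in> nucleus mult \<and> skew star c \<and> star_element mult star c \<and>
     d \<in> left_nucleus mult \<and> bij (\<lambda>x. d \<odot> x) \<and>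
     (\<forall>x y. \<mu>1 *s (x \<odot> y) = (c \<odot> c) \<odot> (x \<odot> y) + \<mu>2 *s ((x \<odot> star d) \<odot> (d \<odot> y)))"

definition cay_map :: "'a \<Rightarrow> 'a \<Rightarrow> 'a \<times> 'a \<Rightarrow> 'a \<times> 'a" where
  "cay_map c d = (\<lambda>(x, y). (x + c \<odot> star y, d \<odot> y))"

lemma module_cay: "module (cay_scale scale)"
  using nonassoc_algebra_cay[of 0] by (simp add: nonassoc_algebra_def)

text \<open>
  Bijectivity is that of a triangular map with diagonal \<open>(id, d)\<close>. In a product of images, the
  equation between \<open>\<mu>\<^sub>1\<close> and \<open>\<mu>\<^sub>2\<close> accounts for the terms without an exact counterpart in the first
  coordinate, while in the second coordinate the terms \<open>v(yc)\<^sup>*\<close> and \<open>y(vc)\<close> cancel: as \<open>c\<close> is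
  skew, their sum is a commutator times \<open>c\<close>.
\<close>

lemma A_isomorphism_if_data:
  assumes "cay_iso_data \<mu>1 \<mu>2 c d"
  shows "A_isomorphism scale mult one star \<mu>1 \<mu>2 (cay_map c d)"
proof -
  have c: "c \<in> nucleus mult" "star_element mult star c" and skew: "star c = - c"
    and d: "d \<in> left_nucleus mult" and bij: "bij (\<lambda>x. d \<odot> x)"
    and norm: "\<mu>1 *s (x \<odot> y) = (c \<odot> c) \<odot> (x \<odot> y) + \<mu>2 *s ((x \<odot> star d) \<odot> (d \<odot> y))" for x y
    using assms by (auto simp: cay_iso_data_def skew_def)
  have nuc: "(c \<odot> x) \<odot> z = c \<odot> (x \<odot> z)" "(x \<odot> c) \<odot> z = x \<odot> (c \<odot> z)"
    "x \<odot> (z \<odot> c) = (x \<odot> z) \<odot> c" for x z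
    using c(1) by (simp_all add: in_nucleus_iff)
  have move: "c \<odot> star x = x \<odot> c" for x
    using c(2) by (simp add: star_element_def star_star)
  have d_assoc: "(d \<odot> x) \<odot> y = d \<odot> (x \<odot> y)" for x y
    using d by (simp add: in_left_nucleus_iff)
  note comm = nuclear_star_element_commutator[OF c]
  have hom: "module_hom (cay_scale scale) (cay_scale scale) (cay_map c d)"
    by (intro module_hom.intro module_cay, unfold_locales)
      (auto simp: cay_map_def mult_add_right mult_scale_right star_add star_scale
        scale_right_distrib)
  have "inj (cay_map c d)"
  proof (rule injI, clarify)
    fix u v x y
    assume eq: "cay_map c d (u, v) = cay_map c d (x, y)"
    then have "v = y"
      using bij by (auto simp: cay_map_def bij_def inj_def)
    then show "u = x \<and> v = y"
      using eq by (simp add: cay_map_def)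
  qed
  moreover have "\<exists>q. p = cay_map c d q" for p
  proof -
    obtain y where "d \<odot> y = snd p"
      using bij by (metis bij_pointE)
    then have "p = cay_map c d (fst p - c \<odot> star y, y)"
      by (simp add: cay_map_def)
    then show ?thesis by blast
  qed
  ultimately have "bij (cay_map c d)"
    by (simp add: bij_def surj_def)
  moreover have "cay_map c d (cay_mult scale mult star \<mu>1 p q) =
    cay_mult scale mult star \<mu>2 (cay_map c d p) (cay_map c d q)" for p q
  proof -
    obtain u v x y where pq: "p = (u, v)" "q = (x, y)"
      by (metis surj_pair)
    have "u \<odot> (y \<odot> c) = (y \<odot> u) \<odot> c"
      using comm(1) by (simp add: nuc)
    moreover have "(v \<odot> c) \<odot> x = (v \<odot> star x) \<odot> c"
      by (metis move nuc(2,3) star_star)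
    moreover have "\<mu>1 *s (star y \<odot> v) =
        (v \<odot> c) \<odot> (y \<odot> c) + \<mu>2 *s (star (d \<odot> y) \<odot> (d \<odot> v))"
      by (simp add: norm nuclear_star_element_mult_square[OF c] star_mult)
    moreover have "(d \<odot> v) \<odot> star (y \<odot> c) + (d \<odot> y) \<odot> (v \<odot> c) = 0"
    proof -
      have "v \<odot> star (y \<odot> c) = - ((v \<odot> y) \<odot> c)"
        by (simp add: star_mult skew mult_minus_left mult_minus_right move nuc(3))
      moreover have "y \<odot> (v \<odot> c) = (v \<odot> y) \<odot> c"
        by (simp add: nuc(3) comm(1)[of y v])
      ultimately show ?thesis
        by (simp add: d_assoc mult_minus_right)
    qed
    ultimately have "(u \<odot> x + \<mu>1 *s (star y \<odot> v)) + (v \<odot> star x + y \<odot> u) \<odot> c =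
        (u + v \<odot> c) \<odot> (x + y \<odot> c) + \<mu>2 *s (star (d \<odot> y) \<odot> (d \<odot> v))"
      and "d \<odot> (v \<odot> star x + y \<odot> u) =
        (d \<odot> v) \<odot> star (x + y \<odot> c) + (d \<odot> y) \<odot> (u + v \<odot> c)"
      by (simp_all only: mult_add_left mult_add_right star_add d_assoc)
        (simp_all add: ac_simps)
    then show ?thesis
      unfolding pq by (simp add: cay_map_def move)
  qed
  ultimately show ?thesis
    using hom
    by (simp add: A_isomorphism_def algebra_iso_def cay_one_def)
      (simp add: cay_map_def star_zero mult_zero)
qed

text \<open>
  Apart from the factorization \<open>(0, y) = (y, 0)(0, 1)\<close>, each property of \<open>c\<close> and \<open>d\<close> is one
  component of multiplicativity on a product of basis type. Only that \<open>c\<close> is nuclear takes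
  several of them: the right nucleus comes from \<open>v(yc) = y(vc) = (vy)c\<close>, the left nucleus by
  applying \<open>*\<close> to the skew element \<open>c\<close>, and the middle nucleus from
  \<open>(vc)x = (vx\<^sup>*)c = v(x\<^sup>* c) = v(cx)\<close>.
\<close>

lemma A_isomorphism_imp_data:
  assumes iso: "A_isomorphism scale mult one star \<mu>1 \<mu>2 \<phi>"
  obtains c d where "cay_iso_data \<mu>1 \<mu>2 c d" "\<phi> = cay_map c d"
proof -
  have hom: "module_hom (cay_scale scale) (cay_scale scale) \<phi>" and bij: "bij \<phi>"
    and mult: "\<phi> (cay_mult scale mult star \<mu>1 p q) =
      cay_mult scale mult star \<mu>2 (\<phi> p) (\<phi> q)"
    and base: "\<phi> (x, 0) = (x, 0)" for p q x
    using iso by (simp_all only: A_isomorphism_def algebra_iso_def)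
  note zero = mult_zero star_zero
  obtain c d where cd: "\<phi> (0, one) = (c, d)"
    by fastforce
  have im: "\<phi> (0, y) = (y \<odot> c, d \<odot> y)" for y
    using mult[of "(y, 0)" "(0, one)"]
    by (simp add: cd base zero mult_one_left star_one)
  have \<phi>: "\<phi> (x, y) = (x + y \<odot> c, d \<odot> y)" for x y
    using module_hom.add[OF hom, of "(x, 0)" "(0, y)"] by (simp add: base im)

  \<comment> \<open>Products \<open>(x, 0)(0, y) = (0, yx)\<close> and \<open>(0, v)(x, 0) = (0, vx\<^sup>*)\<close>.\<close>
  have right: "x \<odot> (y \<odot> c) = (y \<odot> x) \<odot> c"
    and d_assoc: "(d \<odot> y) \<odot> x = d \<odot> (y \<odot> x)" for x y
    using mult[of "(x, 0)" "(0, y)"] by (simp_all add: \<phi> zero)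
  have middle: "(v \<odot> c) \<odot> x = (v \<odot> star x) \<odot> c" for v x
    using mult[of "(0, v)" "(x, 0)"] by (simp add: \<phi> zero)
  have move: "c \<odot> x = star x \<odot> c" for x
    using middle[of one x] by (simp add: mult_one_left)
  \<comment> \<open>Products \<open>(0, v)(0, y) = (\<mu>\<^sub>1 y\<^sup>* v, 0)\<close>.\<close>
  have norm: "\<mu>1 *s (star y \<odot> v) = (v \<odot> c) \<odot> (y \<odot> c) + \<mu>2 *s (star (d \<odot> y) \<odot> (d \<odot> v))"
    and mixed: "d \<odot> (v \<odot> star (y \<odot> c) + y \<odot> (v \<odot> c)) = 0" for v y
    using mult[of "(0, v)" "(0, y)"] by (simp_all add: \<phi> zero d_assoc mult_add_right)

  have cancel: "z = 0" if "d \<odot> z = 0" for z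
  proof -
    \<comment> \<open>The first coordinate is chosen so that \<open>\<phi>\<close> vanishes there.\<close>
    have "\<phi> (- (z \<odot> c), z) = \<phi> (0, 0)"
      using that by (simp add: \<phi> zero)
    then have "(- (z \<odot> c), z) = (0, 0)"
      using bij by (metis bij_is_inj injD)
    then show "z = 0" by simp
  qed
  have "x = y" if "d \<odot> x = d \<odot> y" for x y
    using cancel[of "x + - y"] that
    by (simp only: mult_add_right mult_minus_right) simp
  moreover have "\<exists>y. z = d \<odot> y" for z
    using bij by (metis \<phi> bij_pointE snd_conv surj_pair)
  ultimately have bij_d: "bij (\<lambda>x. d \<odot> x)"
    by (simp add: bij_def inj_def surj_def)

  have skew: "star c = - c"
    using cancel[OF mixed[of one one]]
    by (simp add: mult_one_left eq_neg_iff_add_eq_0)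
  have right': "(v \<odot> y) \<odot> c = v \<odot> (y \<odot> c)" for v y
  proof -
    have "v \<odot> star (y \<odot> c) = - (v \<odot> (y \<odot> c))"
      by (simp add: star_mult skew mult_minus_left mult_minus_right move star_star)
    then have "y \<odot> (v \<odot> c) = v \<odot> (y \<odot> c)"
      using cancel[OF mixed[of v y]] by (simp add: add_eq_0_iff)
    then show ?thesis
      by (simp add: right)
  qed
  have left: "(c \<odot> x) \<odot> y = c \<odot> (x \<odot> y)" for x y
    using arg_cong[OF right'[of "star y" "star x"], of star]
    by (simp add: star_mult star_star skew mult_minus_left mult_minus_right)
  have middle': "(x \<odot> c) \<odot> y = x \<odot> (c \<odot> y)" for x y
    by (simp add: middle right' move)
  have c: "c \<in> nucleus mult" "star_element mult star c"
    using left middle' right' move by (simp_all add: in_nucleus_iff star_element_def)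
  have "\<mu>1 *s (x \<odot> y) = (c \<odot> c) \<odot> (x \<odot> y) + \<mu>2 *s ((x \<odot> star d) \<odot> (d \<odot> y))" for x y
    using norm[of "star x" y]
    by (simp add: nuclear_star_element_mult_square[OF c] star_mult star_star)
  then have "cay_iso_data \<mu>1 \<mu>2 c d"
    using c skew d_assoc bij_d
    by (simp add: cay_iso_data_def skew_def in_left_nucleus_iff)
  moreover have "\<phi> = cay_map c d"
    by (auto simp: cay_map_def \<phi> move star_star)
  ultimately show thesis
    by (rule that)
qed

section \<open>Compatibility with the involutions\<close>

text \<open>
  The equation \<open>b\<^sub>1 = (d\<inverse> b\<^sub>2) d\<close> exhibits \<open>b\<^sub>1\<close> as a product whose factors may be exchanged in
  front of \<open>c\<close>, and the exchanged product is \<open>d (d\<inverse> b\<^sub>2) = b\<^sub>2\<close>.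
\<close>

lemma conjugate_mult_nuclear_star_element:
  assumes c: "c \<in> nucleus mult" "star_element mult star c"
    and d: "d \<in> left_nucleus mult" "bij (\<lambda>x. d \<odot> x)" and conj: "d \<odot> b1 = b2 \<odot> d"
  shows "(b1 \<odot> y) \<odot> c = (b2 \<odot> y) \<odot> c"
proof -
  define e where "e = nuc_inverse mult one d"
  have "b1 = (e \<odot> b2) \<odot> d"
    using conj conjugate_by_nuc_inverse_iff[OF d] by (simp add: e_def)
  then have "b1 \<odot> c = (d \<odot> (e \<odot> b2)) \<odot> c"
    using nuclear_star_element_commutator(1)[OF c, of "e \<odot> b2" d] by simp
  also have "d \<odot> (e \<odot> b2) = b2"
    using nuc_inverse(3)[OF d] d(1) by (metis e_def in_left_nucleus_iff mult_one_left)
  finally have "b1 \<odot> c = b2 \<odot> c" .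
  moreover have "(b \<odot> y) \<odot> c = y \<odot> (b \<odot> c)" for b
    using nuclear_star_element_commutator(1)[OF c, of b y] c(1) by (simp add: in_nucleus_iff)
  ultimately show ?thesis
    by simp
qed

text \<open>
  Two coordinate identities in \<open>y\<close> have to be reduced to their instances at \<open>y = 1\<close>. For the
  second coordinate this holds because \<open>d\<close> and \<open>b\<^sub>2\<close> are left nuclear. For the first, multiply
  the instance at \<open>1\<close> by \<open>y\<^sup>*\<close> on the right; the factors return to the required order because
  \<open>c\<close> and \<open>a\<^sub>2\<close> are nuclear \<open>*\<close>-elements.
\<close>

lemma intertwines_involutions_iff:
  assumes data: "cay_iso_data \<mu>1 \<mu>2 c d"
    and \<gamma>1: "\<And>x y. \<gamma>1 (x, y) = (star x + a1 \<odot> star y, b1 \<odot> y)"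
    and \<gamma>2: "\<And>x y. \<gamma>2 (x, y) = (star x + a2 \<odot> star y, b2 \<odot> y)"
    and a2: "a2 \<in> nucleus mult" "star_element mult star a2"
    and b2: "b2 \<in> left_nucleus mult"
  shows "cay_map c d \<circ> \<gamma>1 = \<gamma>2 \<circ> cay_map c d \<longleftrightarrow>
    a1 = (one + b2) \<odot> star c + a2 \<odot> star d \<and> b1 = (nuc_inverse mult one d \<odot> b2) \<odot> d"
proof -
  have c: "c \<in> nucleus mult" "star_element mult star c" and skew: "star c = - c"
    and d: "d \<in> left_nucleus mult" "bij (\<lambda>x. d \<odot> x)"
    using data by (auto simp: cay_iso_data_def skew_def)
  have move: "c \<odot> star x = x \<odot> c" for x
    using c(2) by (simp add: star_element_def star_star)
  have d_assoc: "(d \<odot> x) \<odot> y = d \<odot> (x \<odot> y)" and b2_assoc: "(b2 \<odot> x) \<odot> y = b2 \<odot> (x \<odot> y)" for x y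
    using d(1) b2 by (simp_all add: in_left_nucleus_iff)
  note cancel = conjugate_mult_nuclear_star_element[OF c d]
  let ?fst = "\<lambda>y. a1 \<odot> star y + (b1 \<odot> y) \<odot> c = - (y \<odot> c) + a2 \<odot> star (d \<odot> y)"
  have coords: "cay_map c d \<circ> \<gamma>1 = \<gamma>2 \<circ> cay_map c d \<longleftrightarrow>
      (\<forall>y. ?fst y \<and> d \<odot> (b1 \<odot> y) = b2 \<odot> (d \<odot> y))"
  proof -
    have "star (y \<odot> c) = - (y \<odot> c)" for y
      by (simp add: star_mult skew mult_minus_left move)
    then have "(cay_map c d \<circ> \<gamma>1) (x, y) = (\<gamma>2 \<circ> cay_map c d) (x, y) \<longleftrightarrow>
        ?fst y \<and> d \<odot> (b1 \<odot> y) = b2 \<odot> (d \<odot> y)" for x y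
      by (simp only: comp_def cay_map_def \<gamma>1 \<gamma>2 move star_add prod.case prod.inject add.assoc
          add_left_cancel)
    then show ?thesis
      by (simp add: fun_eq_iff)
  qed
  have a1_iff: "a1 = (one + b2) \<odot> star c + a2 \<odot> star d \<longleftrightarrow> a1 + b2 \<odot> c = - c + a2 \<odot> star d"
    by (auto simp: skew mult_add_left mult_minus_right mult_one_left algebra_simps)
  have "?fst y \<and> d \<odot> (b1 \<odot> y) = b2 \<odot> (d \<odot> y)"
    if a1: "a1 + b2 \<odot> c = - c + a2 \<odot> star d" and b1: "d \<odot> b1 = b2 \<odot> d" for y
  proof
    have "c \<odot> star y = y \<odot> c"
      by (rule move)
    moreover have "(b2 \<odot> c) \<odot> star y = (b2 \<odot> y) \<odot> c"
      using c(1) by (simp add: b2_assoc move in_nucleus_iff)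
    moreover have "(a2 \<odot> star d) \<odot> star y = a2 \<odot> star (d \<odot> y)"
      using a2(1) nuclear_star_element_commutator(2)[OF a2]
      by (simp add: in_nucleus_iff star_mult)
    ultimately have "a1 \<odot> star y + (b2 \<odot> y) \<odot> c = - (y \<odot> c) + a2 \<odot> star (d \<odot> y)"
      using arg_cong[OF a1, of "\<lambda>z. z \<odot> star y"] by (simp only: mult_add_left mult_minus_left)
    then show "?fst y"
      using cancel[OF b1] by simp
    show "d \<odot> (b1 \<odot> y) = b2 \<odot> (d \<odot> y)"
      by (metis b1 b2_assoc d_assoc)
  qed
  moreover have "a1 + b2 \<odot> c = - c + a2 \<odot> star d \<and> d \<odot> b1 = b2 \<odot> d"
    if "?fst one" "d \<odot> (b1 \<odot> one) = b2 \<odot> (d \<odot> one)"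
    using that cancel[of b1 b2 one] by (simp add: mult_one_left mult_one_right star_one)
  ultimately show ?thesis
    unfolding coords a1_iff conjugate_by_nuc_inverse_iff[OF d] by blast
qed

end

theorem proposition7:
  fixes scale :: "'k::comm_ring_1 \<Rightarrow> 'a::ab_group_add \<Rightarrow> 'a" (infixr \<open>*s\<close> 75)
    and mult :: "'a \<Rightarrow> 'a \<Rightarrow> 'a" (infixl \<open>\<odot>\<close> 70)
    and one :: 'a
    and star :: "'a \<Rightarrow> 'a"
    and \<mu>1 \<mu>2 :: 'k
    and \<gamma>1 \<gamma>2 :: "'a \<times> 'a \<Rightarrow> 'a \<times> 'a"
    and a1 b1 a2 b2 :: 'a
  assumes "star_algebra scale mult one star"
    and "\<mu>1 \<noteq> 0" and "\<mu>2 \<noteq> 0"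
    and "A_involution scale mult star \<mu>1 \<gamma>1"
    and "A_involution scale mult star \<mu>2 \<gamma>2"
    and "\<And>x y. \<gamma>1 (x, y) = (star x + a1 \<odot> star y, b1 \<odot> y)"
    and "\<And>x y. \<gamma>2 (x, y) = (star x + a2 \<odot> star y, b2 \<odot> y)"
    and "a1 \<in> nucleus mult" and "skew star a1" and "star_element mult star a1"
    and "b1 \<in> left_nucleus mult" and "b1 \<odot> b1 = one"
    and "a1 = b1 \<odot> a1"
    and "\<And>x y. \<mu>1 *s (x \<odot> y) = (a1 \<odot> a1) \<odot> (x \<odot> y) + \<mu>1 *s ((x \<odot> star b1) \<odot> (b1 \<odot> y))"
    and "a2 \<in> nucleus mult" and "skew star a2" and "star_element mult star a2"
    and "b2 \<in> left_nucleus mult" and "b2 \<odot> b2 = one"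
    and "a2 = b2 \<odot> a2"
    and "\<And>x y. \<mu>2 *s (x \<odot> y) = (a2 \<odot> a2) \<odot> (x \<odot> y) + \<mu>2 *s ((x \<odot> star b2) \<odot> (b2 \<odot> y))"
  shows
    "(star_A_isomorphic scale mult one star \<mu>1 \<gamma>1 \<mu>2 \<gamma>2 \<longleftrightarrow>
       (\<exists>c d. c \<in> nucleus mult \<and> skew star c \<and> star_element mult star c \<and>
          d \<in> left_nucleus mult \<and> bij (\<lambda>x. d \<odot> x) \<and>
          (\<forall>x y. \<mu>1 *s (x \<odot> y) = (c \<odot> c) \<odot> (x \<odot> y) + \<mu>2 *s ((x \<odot> star d) \<odot> (d \<odot> y))) \<and>
          a1 = (one + b2) \<odot> star c + a2 \<odot> star d \<and>
          b1 = (nuc_inverse mult one d \<odot> b2) \<odot> d)) \<and>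
     (\<forall>d. d \<in> left_nucleus mult \<and> bij (\<lambda>x. d \<odot> x) \<longrightarrow>
        nuc_inverse mult one d \<in> left_nucleus mult \<and>
        (\<forall>e. d \<odot> e = one \<longleftrightarrow> e = nuc_inverse mult one d) \<and>
        (\<forall>e \<in> left_nucleus mult. e \<odot> d = one \<longleftrightarrow> e = nuc_inverse mult one d)) \<and>
     (\<forall>c d. c \<in> nucleus mult \<and> skew star c \<and> star_element mult star c \<and>
        d \<in> left_nucleus mult \<and> bij (\<lambda>x. d \<odot> x) \<and>
        (\<forall>x y. \<mu>1 *s (x \<odot> y) = (c \<odot> c) \<odot> (x \<odot> y) + \<mu>2 *s ((x \<odot> star d) \<odot> (d \<odot> y))) \<and>
        a1 = (one + b2) \<odot> star c + a2 \<odot> star d \<and>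
        b1 = (nuc_inverse mult one d \<odot> b2) \<odot> d \<longrightarrow>
        star_A_isomorphism scale mult one star \<mu>1 \<gamma>1 \<mu>2 \<gamma>2
          (\<lambda>(x, y). (x + c \<odot> star y, d \<odot> y)))"
proof -
  interpret star_algebra scale mult one star
    by (fact assms(1))
  note intertwines = intertwines_involutions_iff[OF _ assms(6,7,15,17,18)]
  let ?cond = "\<lambda>c d. cay_iso_data \<mu>1 \<mu>2 c d \<and>
    a1 = (one + b2) \<odot> star c + a2 \<odot> star d \<and> b1 = (nuc_inverse mult one d \<odot> b2) \<odot> d"
  have sufficient: "star_A_isomorphism scale mult one star \<mu>1 \<gamma>1 \<mu>2 \<gamma>2 (cay_map c d)"
    if "?cond c d" for c d
    using that intertwines[of \<mu>1 \<mu>2 c d] A_isomorphism_if_data[of \<mu>1 \<mu>2 c d]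
    by (simp add: star_A_isomorphism_def)
  have necessary: "\<exists>c d. ?cond c d"
    if "star_A_isomorphism scale mult one star \<mu>1 \<gamma>1 \<mu>2 \<gamma>2 \<phi>" for \<phi>
  proof -
    have iso: "A_isomorphism scale mult one star \<mu>1 \<mu>2 \<phi>" and "\<phi> \<circ> \<gamma>1 = \<gamma>2 \<circ> \<phi>"
      using that by (simp_all add: star_A_isomorphism_def)
    moreover obtain c d where "cay_iso_data \<mu>1 \<mu>2 c d" "\<phi> = cay_map c d"
      using A_isomorphism_imp_data[OF iso] .
    ultimately show ?thesis
      using intertwines by blast
  qed
  have iff: "star_A_isomorphic scale mult one star \<mu>1 \<gamma>1 \<mu>2 \<gamma>2 \<longleftrightarrow> (\<exists>c d. ?cond c d)"
    unfolding star_A_isomorphic_def using sufficient necessary by blast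
  have explicit: "\<forall>c d. ?cond c d \<longrightarrow>
      star_A_isomorphism scale mult one star \<mu>1 \<gamma>1 \<mu>2 \<gamma>2 (cay_map c d)"
    using sufficient by blast
  have inverse: "\<forall>d. d \<in> left_nucleus mult \<and> bij (\<lambda>x. d \<odot> x) \<longrightarrow>
      nuc_inverse mult one d \<in> left_nucleus mult \<and>
      (\<forall>e. d \<odot> e = one \<longleftrightarrow> e = nuc_inverse mult one d) \<and>
      (\<forall>e \<in> left_nucleus mult. e \<odot> d = one \<longleftrightarrow> e = nuc_inverse mult one d)"
    by (simp add: nuc_inverse(1) right_inverse_iff left_inverse_iff)
  show ?thesis
    by (intro conjI iff[unfolded cay_iso_data_def conj_assoc] inverse
        explicit[unfolded cay_iso_data_def cay_map_def conj_assoc])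
qed

end
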